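(* Let $B$ be a Boolean program expression, $r$ a state predicate and $S$ a statement on state space $\Sigma$. Let $W \neq \emptyset$ be a well-founded set with order $<$, let $p$ be a state predicate (the invariant) and $v : \Sigma \to W$ (the variant), and put $p_w = p \wedge (\lambda\sigma.\ v\,\sigma = w)$ for $w \in W$ and $p_{<w} = \lambda \sigma.\ \exists w' \in W.\ w' < w \wedge p_{w'}\,\sigma$. Then \[\big(\forall w \in W\cdot \{p_w \wedge \mathsf{def}\,B \wedge \mathsf{val}\,B\}\ S\ \{p_{<w}, r\}\big) \Rightarrow \{p\}\ \mathsf{while}\ B\ \mathsf{do}\ S\ \{p \wedge \mathsf{def}\,B \wedge \neg\mathsf{val}\,B,\ (p \wedge \neg\mathsf{def}\,B) \vee r\}\] and \[\big(\forall w \in W\cdot \{|p_w \wedge \mathsf{def}\,B \wedge \mathsf{val}\,B|\}\ S\ \{|p_{<w}, r|\}\big) \Rightarrow \{|p|\}\ \mathsf{while}\ B\ \mathsf{do}\ S\ \{|p \wedge \mathsf{def}\,B \wedge \neg\mathsf{val}\,B,\ r|\}.\]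
   Context: A state predicate on $\Sigma$ is a function $\Sigma\to Bool$; logical operations are pointwise and $u \le v$ iff $\forall\sigma.\ u\,\sigma\Rightarrow v\,\sigma$. A statement on $\Sigma$ is a monotonic predicate transformer $S : \mathcal P\Sigma\times\mathcal P\Sigma\to\mathcal P\Sigma$, where $S(q,r)$ is the weakest precondition for terminating normally in $q$ or exceptionally in $r$. Definitions: $\mathsf{skip}(q,r)=q$, $(S;T)(q,r)=S(T(q,r),r)$, $(S\sqcap T)(q,r)=S(q,r)\wedge T(q,r)$, $[u,v](q,r)=(u\Rightarrow q)\wedge(v\Rightarrow r)$, $[u](q,r) = (u\Rightarrow q)$. A Boolean program expression $B$ has a definedness predicate $\mathsf{def}\,B$ and a value predicate $\mathsf{val}\,B$. Conditional: $\mathsf{if}\ B\ \mathsf{then}\ S\ \mathsf{else}\ T = [\mathsf{def}\,B,\neg\mathsf{def}\,B];(([\mathsf{val}\,B];S)\sqcap([\neg\mathsf{val}\,B];T))$. Total refinement $S\sqsubseteq T$ iff $\forall q,r.\ S(q,r)\le T(q,r)$; statements form a complete lattice under it. Loop: $\mathsf{while}\ B\ \mathsf{do}\ S = \mu(\lambda X.\ \mathsf{if}\ B\ \mathsf{then}\ S;X\ \mathsf{else}\ \mathsf{skip})$, the least fixed point w.r.t. $\sqsubseteq$. Total correctness: $\{p\}\ S\ \{q,r\} = (p \le S(q,r))$. Partial correctness: $\{|p|\}\ S\ \{|q,r|\} = (p \le S(q, p\vee r))$. *)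

theory Defs
  imports "HOL-Library.Product_Order"
begin

type_synonym 's pred = "'s \<Rightarrow> bool"

text \<open>
  Pairs of postconditions (normal, exceptional) are ordered componentwise, and predicates pointwise
  by implication.
\<close>

typedef 's stmt = "{S :: 's pred \<times> 's pred \<Rightarrow> 's pred. mono S}"
  morphisms wp Abs_stmt
  by (rule exI[of _ "\<lambda>_. bot"]) (simp add: mono_def)

setup_lifting type_definition_stmt

lemma mono_wp: "mono (wp S)"
  using wp by simp

lemma wp_mono: "q \<le> q' \<Longrightarrow> r \<le> r' \<Longrightarrow> wp S (q, r) \<le> wp S (q', r')"
  by (rule monoD[OF mono_wp]) simp

lemma mono_Inf_fun:
  fixes M :: "('a::order \<Rightarrow> 'b::complete_lattice) set"
  assumes "\<And>f. f \<in> M \<Longrightarrow> mono f"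
  shows "mono (Inf M)"
proof (rule monoI)
  fix x y :: 'a
  assume "x \<le> y"
  then have "f x \<le> f y" if "f \<in> M" for f
    using assms[OF that] by (simp add: monoD)
  then show "Inf M x \<le> Inf M y"
    unfolding Inf_apply by (rule INF_superset_mono[OF order_refl])
qed

lemma mono_Sup_fun:
  fixes M :: "('a::order \<Rightarrow> 'b::complete_lattice) set"
  assumes "\<And>f. f \<in> M \<Longrightarrow> mono f"
  shows "mono (Sup M)"
proof (rule monoI)
  fix x y :: 'a
  assume "x \<le> y"
  then have "f x \<le> f y" if "f \<in> M" for f
    using assms[OF that] by (simp add: monoD)
  then show "Sup M x \<le> Sup M y"
    unfolding Sup_apply by (rule SUP_subset_mono[OF order_refl])
qed

text \<open>
  The order and the lattice operations are inherited pointwise from the function space: the order is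
  total refinement and the binary infimum is demonic choice.
\<close>

instantiation stmt :: (type) complete_lattice
begin

lift_definition less_eq_stmt :: "'a stmt \<Rightarrow> 'a stmt \<Rightarrow> bool" is "(\<le>)" .

lift_definition less_stmt :: "'a stmt \<Rightarrow> 'a stmt \<Rightarrow> bool" is "(<)" .

lift_definition inf_stmt :: "'a stmt \<Rightarrow> 'a stmt \<Rightarrow> 'a stmt" is inf
  unfolding mono_def inf_fun_def[where 'a="'a pred \<times> 'a pred"] by (meson inf_mono)

lift_definition sup_stmt :: "'a stmt \<Rightarrow> 'a stmt \<Rightarrow> 'a stmt" is sup
  unfolding mono_def sup_fun_def[where 'a="'a pred \<times> 'a pred"] by (meson sup_mono)

lift_definition bot_stmt :: "'a stmt" is bot
  by (rule monoI) simp

lift_definition top_stmt :: "'a stmt" is top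
  by (rule monoI) simp

lift_definition Inf_stmt :: "'a stmt set \<Rightarrow> 'a stmt" is Inf
  by (rule mono_Inf_fun)

lift_definition Sup_stmt :: "'a stmt set \<Rightarrow> 'a stmt" is Sup
  by (rule mono_Sup_fun)

instance
  by (standard; transfer)
     (auto intro: Inf_lower Inf_greatest Sup_upper Sup_least simp: less_le_not_le)

end

lemma le_stmt_iff: "S \<le> T \<longleftrightarrow> (\<forall>q r. wp S (q, r) \<le> wp T (q, r))"
  by (simp add: less_eq_stmt.rep_eq le_fun_def[of "wp S"])

lemma wp_inf: "wp (inf S T) (q, r) \<sigma> \<longleftrightarrow> wp S (q, r) \<sigma> \<and> wp T (q, r) \<sigma>"
  by (simp add: inf_stmt.rep_eq)

lift_definition skip :: "'s stmt" is "\<lambda>(q, r). q"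
  by (auto simp: mono_def)

lift_definition seq :: "'s stmt \<Rightarrow> 's stmt \<Rightarrow> 's stmt"  (infixr \<open>;;\<close> 60)
  is "\<lambda>S T (q, r). S (T (q, r), r)"
  by (auto simp: mono_def)

lift_definition assume2 :: "'s pred \<Rightarrow> 's pred \<Rightarrow> 's stmt"
  is "\<lambda>u v (q, r) \<sigma>. (u \<sigma> \<longrightarrow> q \<sigma>) \<and> (v \<sigma> \<longrightarrow> r \<sigma>)"
  by (auto simp: mono_def le_fun_def)

lift_definition assume1 :: "'s pred \<Rightarrow> 's stmt"
  is "\<lambda>u (q, r) \<sigma>. u \<sigma> \<longrightarrow> q \<sigma>"
  by (auto simp: mono_def le_fun_def)

datatype 's bexp = BExp (Def: "'s pred") (Val: "'s pred")

definition cond :: "'s bexp \<Rightarrow> 's stmt \<Rightarrow> 's stmt \<Rightarrow> 's stmt" where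
  "cond B S T =
     assume2 (Def B) (\<lambda>\<sigma>. \<not> Def B \<sigma>) ;;
     inf (assume1 (Val B) ;; S) (assume1 (\<lambda>\<sigma>. \<not> Val B \<sigma>) ;; T)"

definition while_do :: "'s bexp \<Rightarrow> 's stmt \<Rightarrow> 's stmt" where
  "while_do B S = lfp (\<lambda>X. cond B (S ;; X) skip)"

lemma wp_cond:
  "wp (cond B S T) (q, r) \<sigma> \<longleftrightarrow>
     (if Def B \<sigma> then if Val B \<sigma> then wp S (q, r) \<sigma> else wp T (q, r) \<sigma> else r \<sigma>)"
  unfolding cond_def by transfer auto

lemma mono_while_body: "mono (\<lambda>X. cond B (S ;; X) skip)"
proof (rule monoI)
  fix X Y :: "'a stmt"
  assume "X \<le> Y"
  then have "wp (S ;; X) (q, r) \<le> wp (S ;; Y) (q, r)" for q r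
    by transfer (auto elim!: monoD)
  then show "cond B (S ;; X) skip \<le> cond B (S ;; Y) skip"
    by (auto simp: less_eq_stmt.rep_eq le_fun_def wp_cond)
qed

lemma while_do_unfold: "while_do B S = cond B (S ;; while_do B S) skip"
  unfolding while_do_def by (rule lfp_unfold[OF mono_while_body])

definition total_correct :: "'s pred \<Rightarrow> 's stmt \<Rightarrow> 's pred \<Rightarrow> 's pred \<Rightarrow> bool" where
  "total_correct p S q r \<longleftrightarrow> p \<le> wp S (q, r)"

definition partial_correct :: "'s pred \<Rightarrow> 's stmt \<Rightarrow> 's pred \<Rightarrow> 's pred \<Rightarrow> bool" where
  "partial_correct p S q r \<longleftrightarrow> p \<le> wp S (q, \<lambda>\<sigma>. p \<sigma> \<or> r \<sigma>)"

definition inv_at :: "'s pred \<Rightarrow> ('s \<Rightarrow> 'w) \<Rightarrow> 'w \<Rightarrow> 's pred" where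
  "inv_at p v w = (\<lambda>\<sigma>. p \<sigma> \<and> v \<sigma> = w)"

definition inv_below ::
    "'w set \<Rightarrow> ('w \<Rightarrow> 'w \<Rightarrow> bool) \<Rightarrow> 's pred \<Rightarrow> ('s \<Rightarrow> 'w) \<Rightarrow> 'w \<Rightarrow> 's pred" where
  "inv_below W lt p v w = (\<lambda>\<sigma>. \<exists>w'\<in>W. lt w' w \<and> inv_at p v w' \<sigma>)"

end

theory Submission imports Defs begin

lemma wp_seq: "wp (S ;; T) (q, r) = wp S (wp T (q, r), r)"
  by transfer simp

lemma wp_skip: "wp skip (q, r) = q"
  by transfer simp

text \<open>
  Total and partial correctness of loops are both instances of the following rule: only the
  exceptional postcondition differs, and it has to cover the states of the invariant in which the
  guard is undefined.
\<close>

lemma while_do_variant_rule: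
  assumes wf: "wfp_on W lt"
    and variant: "\<And>\<sigma>. p \<sigma> \<Longrightarrow> v \<sigma> \<in> W"
    and undef: "\<And>\<sigma>. p \<sigma> \<Longrightarrow> \<not> Def B \<sigma> \<Longrightarrow> R \<sigma>"
    and body: "\<And>w. w \<in> W \<Longrightarrow>
      total_correct (\<lambda>\<sigma>. inv_at p v w \<sigma> \<and> Def B \<sigma> \<and> Val B \<sigma>) S (inv_below W lt p v w) R"
  shows "total_correct p (while_do B S) (\<lambda>\<sigma>. p \<sigma> \<and> Def B \<sigma> \<and> \<not> Val B \<sigma>) R"
proof -
  let ?L = "wp (while_do B S) (\<lambda>\<sigma>. p \<sigma> \<and> Def B \<sigma> \<and> \<not> Val B \<sigma>, R)"
  \<comment> \<open>Slicing the invariant by the value of the variant makes well-founded induction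
    on that value applicable; the slices together cover \<open>p\<close>.\<close>
  have "inv_at p v w \<le> ?L" if "w \<in> W" for w
    using wf
  proof (induction w rule: wfp_on_induct)
    case in_set
    show ?case by (rule that)
  next
    case (less w)
    have "inv_below W lt p v w \<le> ?L"
      using less.IH by (auto simp: inv_below_def le_fun_def)
    \<comment> \<open>By monotonicity of \<open>S\<close>, the smaller slices as normal
      postcondition can be replaced by the precondition of the remaining loop, as required after
      unfolding.\<close>
    then have step: "wp S (inv_below W lt p v w, R) \<le> wp S (?L, R)"
      by (rule wp_mono) simp
    show ?case
    proof (rule predicate1I)
      fix \<sigma> assume inv: "inv_at p v w \<sigma>"
      then have "p \<sigma>"
        by (simp add: inv_at_def)
      moreover have "wp S (?L, R) \<sigma>" if "Def B \<sigma>" "Val B \<sigma>"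
        using body[OF less.hyps] step inv that by (auto simp: total_correct_def le_fun_def)
      ultimately show "?L \<sigma>"
        \<comment> \<open>One unfolding leaves three cases: an undefined guard exits exceptionally,
          covered by \<open>undef\<close>; a true guard is the case just shown; a false guard ends
          in \<open>skip\<close>, where \<open>p\<close> still holds.\<close>
        using undef by (subst while_do_unfold) (simp add: wp_cond wp_seq wp_skip)
    qed
  qed
  then show ?thesis
    using variant by (auto simp: total_correct_def le_fun_def inv_at_def)
qed

lemma total_correct_weaken_exceptional:
  assumes "total_correct p S q r" and "r \<le> r'"
  shows "total_correct p S q r'"
  using assms wp_mono[of q q r r' S] by (auto simp: total_correct_def)

text \<open>Lets the rule for total correctness serve partial correctness too, with the precondition
  absorbed into the exceptional postcondition.\<close>

lemma partial_correct_iff_total_correct: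
  "partial_correct p S q r \<longleftrightarrow> total_correct p S q (\<lambda>\<sigma>. p \<sigma> \<or> r \<sigma>)"
  by (simp add: partial_correct_def total_correct_def)

theorem theorem4:
  fixes B :: "'s bexp" and r :: "'s pred" and S :: "'s stmt"
    and W :: "'w set" and lt :: "'w \<Rightarrow> 'w \<Rightarrow> bool"
    and p :: "'s pred" and v :: "'s \<Rightarrow> 'w"
  assumes "W \<noteq> {}"
    and "irreflp_on W lt" and "transp_on W lt" and "wfp_on W lt"
    and "\<And>\<sigma>. v \<sigma> \<in> W"
  shows
    "((\<forall>w\<in>W. total_correct (\<lambda>\<sigma>. inv_at p v w \<sigma> \<and> Def B \<sigma> \<and> Val B \<sigma>) S (inv_below W lt p v w) r) \<longrightarrow>
       total_correct p (while_do B S)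
         (\<lambda>\<sigma>. p \<sigma> \<and> Def B \<sigma> \<and> \<not> Val B \<sigma>) (\<lambda>\<sigma>. (p \<sigma> \<and> \<not> Def B \<sigma>) \<or> r \<sigma>)) \<and>
     ((\<forall>w\<in>W. partial_correct (\<lambda>\<sigma>. inv_at p v w \<sigma> \<and> Def B \<sigma> \<and> Val B \<sigma>) S (inv_below W lt p v w) r) \<longrightarrow>
       partial_correct p (while_do B S)
         (\<lambda>\<sigma>. p \<sigma> \<and> Def B \<sigma> \<and> \<not> Val B \<sigma>) r)"
proof (intro conjI impI)
  assume body: "\<forall>w\<in>W. total_correct (\<lambda>\<sigma>. inv_at p v w \<sigma> \<and> Def B \<sigma> \<and> Val B \<sigma>) S
    (inv_below W lt p v w) r"
  show "total_correct p (while_do B S) (\<lambda>\<sigma>. p \<sigma> \<and> Def B \<sigma> \<and> \<not> Val B \<sigma>)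
    (\<lambda>\<sigma>. (p \<sigma> \<and> \<not> Def B \<sigma>) \<or> r \<sigma>)"
    \<comment> \<open>Here \<open>R\<close> is \<open>r\<close> joined with the invariant states of
      undefined guard, so the body's \<open>r\<close> only has to be weakened.\<close>
    by (rule while_do_variant_rule[where v = v, OF \<open>wfp_on W lt\<close> assms(5)])
      (auto intro: total_correct_weaken_exceptional[OF body[rule_format]])
next
  assume body: "\<forall>w\<in>W. partial_correct (\<lambda>\<sigma>. inv_at p v w \<sigma> \<and> Def B \<sigma> \<and> Val B \<sigma>) S
    (inv_below W lt p v w) r"
  show "partial_correct p (while_do B S) (\<lambda>\<sigma>. p \<sigma> \<and> Def B \<sigma> \<and> \<not> Val B \<sigma>) r"
    unfolding partial_correct_iff_total_correct
  proof (rule while_do_variant_rule[where v = v, OF \<open>wfp_on W lt\<close> assms(5)])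
    show "total_correct (\<lambda>\<sigma>. inv_at p v w \<sigma> \<and> Def B \<sigma> \<and> Val B \<sigma>) S
      (inv_below W lt p v w) (\<lambda>\<sigma>. p \<sigma> \<or> r \<sigma>)" if "w \<in> W" for w
      \<comment> \<open>The body may exit exceptionally in its own precondition or in
        \<open>r\<close>; that precondition contains \<open>p\<close> through \<open>inv_at\<close>,
        so both lie in \<open>p\<close> or \<open>r\<close>.\<close>
      using body[rule_format, OF that, unfolded partial_correct_iff_total_correct]
      by (rule total_correct_weaken_exceptional) (auto simp: inv_at_def)
  qed simp
qed

end
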